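(* Let $a<b$ be real numbers, let $N\ge 0$ be an integer, and let $f:[a,b]\to\mathbb{R}$ be a function whose $N$th derivative $f^{(N)}$ exists on $[a,b]$ and is absolutely continuous on $[a,b]$. Then for all $x\in[a,b]$, $$f(x)=f(a)+(x-a)f'(a)+\frac{(x-a)^2}{2!}f''(a)+\cdots+\frac{(x-a)^N}{N!}f^{(N)}(a)+R_N(x),$$ where $R_N(x)$ is given exactly by $$R_N(x)=\int_a^x\frac{(x-t)^N}{N!}\,f^{(N+1)}(t)\,dt,$$ and $R_N(x)$ satisfies the inequality $$|R_N(x)|\le \sup_{c\in[a,x]}|f^{(N+1)}(c)|\;\frac{(x-a)^{N+1}}{(N+1)!}.$$
   Context: Here $f^{(0)}=f$, and derivatives at the endpoints of $[a,b]$ are one-sided. Integrals are Lebesgue integrals. The function $f^{(N+1)}$ denotes the derivative of the absolutely continuous function $f^{(N)}$; it exists almost everywhere on $[a,b]$ and belongs to $L^1[a,b]$. The supremum $\sup_{c\in[a,x]}|f^{(N+1)}(c)|$ is taken over those points $c\in[a,x]$ at which $f^{(N+1)}(c)$ exists, as an element of $[0,\infty]$ (the supremum of the empty set is $0$), with the convention $\infty\cdot 0=0$. The convention $0^0=1$ is used. *)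

theory Defs
  imports "HOL-Analysis.Analysis"
begin

(* For S = {a..b} the filter "at x within S" yields one-sided derivatives at the endpoints
   and two-sided ones inside, and only the values of f on S matter for x in S.
   Where the derivative does not exist, vector_derivative is an unspecified real number;
   existence is expressed separately by "differentiable" and by has_nth_deriv_on. *)
primrec nth_deriv_on :: "real set \<Rightarrow> nat \<Rightarrow> (real \<Rightarrow> real) \<Rightarrow> real \<Rightarrow> real" where
  "nth_deriv_on S 0 f = f"
| "nth_deriv_on S (Suc n) f = (\<lambda>x. vector_derivative (nth_deriv_on S n f) (at x within S))"

definition has_nth_deriv_on :: "real set \<Rightarrow> nat \<Rightarrow> (real \<Rightarrow> real) \<Rightarrow> bool" where
  "has_nth_deriv_on S n f \<longleftrightarrow>
     (\<forall>k<n. \<forall>x\<in>S. nth_deriv_on S k f differentiable (at x within S))"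

(* The epsilon-delta notion for functions of a real variable; a pair (u, v) encodes an interval.
   Not to be confused with the relation absolutely_continuous between measures. *)
definition absolutely_continuous_on :: "real set \<Rightarrow> (real \<Rightarrow> real) \<Rightarrow> bool" where
  "absolutely_continuous_on S f \<longleftrightarrow>
     (\<forall>\<epsilon>>0. \<exists>\<delta>>0. \<forall>P.
        finite P \<and> (\<forall>(u, v)\<in>P. u < v \<and> {u..v} \<subseteq> S) \<and>
        disjoint_family_on (\<lambda>(u, v). {u<..<v}) P \<and>
        (\<Sum>(u, v)\<in>P. v - u) < \<delta>
        \<longrightarrow> (\<Sum>(u, v)\<in>P. \<bar>f v - f u\<bar>) < \<epsilon>)"

end

theory Submission
  imports Defs
begin

text \<open>Taylor's formula with integral remainder is the fundamental theorem of calculus for the function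
\<open>t \<mapsto> (\<Sum>k\<le>N. (x - t)^k / k! * f^(k)(t))\<close>. It equals \<open>f x\<close> at \<open>t = x\<close> and the Taylor polynomial at
\<open>t = a\<close>, it is absolutely continuous because \<open>f^(k)\<close> is \<open>C^1\<close> for \<open>k < N\<close> and absolutely continuous
for \<open>k = N\<close>, and its derivative telescopes to \<open>(x - t)^N / N! * f^(N+1)(t)\<close> wherever \<open>f^(N)\<close> is
differentiable. The estimate of the remainder bounds \<open>f^(N+1)\<close> by its supremum off the null set where
it does not exist and integrates \<open>(x - t)^N / N!\<close>.

So the content is the fundamental theorem for an absolutely continuous \<open>g\<close>, in three parts.

First, \<open>g\<close> is differentiable almost everywhere (\<open>absolutely_continuous_differentiable_ae\<close>). On short
intervals \<open>g\<close> has bounded variation, and for functions of bounded variation the argument is close to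
Austin's geometric proof of Lebesgue's theorem. Let \<open>V\<close> be the variation function. By the Vitali
covering theorem, the points lying in arbitrarily short intervals on which a monotone function \<open>W\<close>
has slope at least \<open>\<alpha>\<close> form a set of outer measure at most \<open>(W q - W p) / \<alpha>\<close>
(\<open>mono_increments_outer_measure\<close>). With \<open>W = V\<close> and \<open>\<alpha>\<close> large, the difference quotients of \<open>g\<close> are
bounded near almost every point. If they have slopes above \<open>\<alpha>\<close> and below \<open>-\<alpha>\<close> near each point of a
set, take a division whose sum \<open>\<Sum>\<bar>\<Delta>g\<bar>\<close> is almost \<open>V q - V p\<close>, and on each of its intervals let \<open>W\<close> be
\<open>V - g\<close> or \<open>V + g\<close>, depending on whether \<open>g\<close> increases or decreases across it: the total
increment of these functions is as small as desired, while every interval on which \<open>g\<close> has slope of the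
opposite sign contributes at least \<open>\<alpha>\<close> times its length. Hence the set is null.

Second, the derivative has Henstock-Kurzweil integral \<open>g b - g a\<close>
(\<open>absolutely_continuous_has_integral\<close>): tags outside the exceptional null set are treated as in the
classical theorem, and those inside it are given a gauge that confines their intervals to an open set
of small measure, where absolute continuity makes the sum of the increments small.

Third, that integral has bounded variation over short intervals, so the derivative is
Lebesgue integrable (\<open>absolutely_continuous_absolutely_integrable_derivative\<close>).\<close>

section \<open>Increments over nonoverlapping intervals\<close>

text \<open>Absolute continuity for indexed families in which degenerate intervals, and hence repetitions, are
allowed, as happens in tagged divisions.\<close>

lemma absolutely_continuous_onE:
  fixes g :: "real \<Rightarrow> real"
  assumes "absolutely_continuous_on S g" and "e > 0"
  obtains d where "d > 0"
    and "\<And>(I :: 'i set) u v. \<lbrakk>finite I; \<And>i. i \<in> I \<Longrightarrow> u i \<le> v i \<and> {u i..v i} \<subseteq> S;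
           disjoint_family_on (\<lambda>i. {u i<..<v i}) I; (\<Sum>i\<in>I. v i - u i) < d\<rbrakk>
         \<Longrightarrow> (\<Sum>i\<in>I. \<bar>g (v i) - g (u i)\<bar>) < e"
proof -
  obtain d where "d > 0" and d: "\<And>P. finite P \<Longrightarrow> (\<forall>(u, v)\<in>P. u < v \<and> {u..v} \<subseteq> S) \<Longrightarrow>
        disjoint_family_on (\<lambda>(u, v). {u<..<v}) P \<Longrightarrow>
        (\<Sum>(u, v)\<in>P. v - u) < d \<Longrightarrow> (\<Sum>(u, v)\<in>P. \<bar>g v - g u\<bar>) < e"
    using assms(1)[unfolded absolutely_continuous_on_def, rule_format, OF assms(2)] by auto
  show ?thesis
  proof
    show "d > 0" by fact
  next
    fix I :: "'i set" and u v :: "'i \<Rightarrow> real"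
    assume I: "finite I" "\<And>i. i \<in> I \<Longrightarrow> u i \<le> v i \<and> {u i..v i} \<subseteq> S"
      "disjoint_family_on (\<lambda>i. {u i<..<v i}) I" "(\<Sum>i\<in>I. v i - u i) < d"
    define J where "J = {i\<in>I. u i < v i}"
    define P where "P = (\<lambda>i. (u i, v i)) ` J"
    have J: "finite J" "J \<subseteq> I" and eq: "\<And>i. i \<in> I - J \<Longrightarrow> u i = v i"
      using I unfolding J_def by (auto simp: order_le_less)
    have inj: "inj_on (\<lambda>i. (u i, v i)) J"
    proof (rule inj_onI)
      fix i j assume ij: "i \<in> J" "j \<in> J" "(u i, v i) = (u j, v j)"
      have "{u i<..<v i} \<inter> {u j<..<v j} \<noteq> {}" using ij by (auto simp: J_def)
      then show "i = j" using I(3) ij J(2) unfolding disjoint_family_on_def by blast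
    qed
    have "(\<Sum>(u, v)\<in>P. \<bar>g v - g u\<bar>) < e"
    proof (rule d)
      show "finite P" using J by (simp add: P_def)
      show "\<forall>(u, v)\<in>P. u < v \<and> {u..v} \<subseteq> S" using I(2) by (auto simp: P_def J_def)
      show "disjoint_family_on (\<lambda>(u, v). {u<..<v}) P"
        unfolding disjoint_family_on_def
      proof (intro ballI impI)
        fix a b assume "a \<in> P" "b \<in> P" "a \<noteq> b"
        then obtain i j where "i \<in> J" "j \<in> J" "i \<noteq> j" "a = (u i, v i)" "b = (u j, v j)"
          unfolding P_def by blast
        then show "(case a of (u, v) \<Rightarrow> {u<..<v}) \<inter> (case b of (u, v) \<Rightarrow> {u<..<v}) = {}"
          using I(3) J(2) unfolding disjoint_family_on_def by (simp add: subset_iff)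
      qed
      have "(\<Sum>(u, v)\<in>P. v - u) = (\<Sum>i\<in>J. v i - u i)"
        unfolding P_def by (subst sum.reindex[OF inj]) simp
      also have "\<dots> = (\<Sum>i\<in>I. v i - u i)"
        using J eq I(1) by (intro sum.mono_neutral_left) auto
      finally show "(\<Sum>(u, v)\<in>P. v - u) < d" using I(4) by simp
    qed
    also have "(\<Sum>(u, v)\<in>P. \<bar>g v - g u\<bar>) = (\<Sum>i\<in>J. \<bar>g (v i) - g (u i)\<bar>)"
      unfolding P_def by (subst sum.reindex[OF inj]) simp
    also have "\<dots> = (\<Sum>i\<in>I. \<bar>g (v i) - g (u i)\<bar>)"
      using J eq I(1) by (intro sum.mono_neutral_left) auto
    finally show "(\<Sum>i\<in>I. \<bar>g (v i) - g (u i)\<bar>) < e" .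
  qed
qed

text \<open>The images \<open>(W u, W v)\<close> of nonoverlapping intervals \<open>(u, v)\<close> are disjoint subintervals of
\<open>[W p, W q]\<close>, so the claim compares Lebesgue measures.\<close>

lemma sum_increments_le:
  fixes W :: "real \<Rightarrow> real"
  assumes W: "mono_on {p..q} W" and "p \<le> q" and I: "finite I"
    and uv: "\<And>i. i \<in> I \<Longrightarrow> p \<le> u i \<and> u i \<le> v i \<and> v i \<le> q"
    and disj: "disjoint_family_on (\<lambda>i. {u i<..<v i}) I"
  shows "(\<Sum>i\<in>I. W (v i) - W (u i)) \<le> W q - W p"
proof -
  have le: "W x \<le> W y" if "p \<le> x" "x \<le> y" "y \<le> q" for x y
    using W that by (auto intro: mono_onD)
  have dis: "disjoint_family_on (\<lambda>i. {W (u i)<..<W (v i)}) I"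
    unfolding disjoint_family_on_def
  proof (intro ballI impI)
    fix i j assume ij: "i \<in> I" "j \<in> I" "i \<noteq> j"
    have "{u i<..<v i} \<inter> {u j<..<v j} = {}" using disj ij unfolding disjoint_family_on_def by blast
    then have "u i = v i \<or> u j = v j \<or> v i \<le> u j \<or> v j \<le> u i"
      using uv[OF ij(1)] uv[OF ij(2)] dense[of "max (u i) (u j)" "min (v i) (v j)"]
      by (auto simp: disjoint_iff)
    then show "{W (u i)<..<W (v i)} \<inter> {W (u j)<..<W (v j)} = {}"
      using uv[OF ij(1)] uv[OF ij(2)] le[of "v i" "u j"] le[of "v j" "u i"] by auto
  qed
  have "(\<Sum>i\<in>I. W (v i) - W (u i)) = (\<Sum>i\<in>I. measure lborel {W (u i)<..<W (v i)})"
    using uv by (intro sum.cong refl) (auto simp: le)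
  also have "\<dots> = measure lborel (\<Union>i\<in>I. {W (u i)<..<W (v i)})"
    using I dis uv by (intro measure_finite_Union[symmetric]) (auto simp: le emeasure_lborel_Ioo)
  also have "\<dots> \<le> measure lborel {W p..W q}"
  proof (rule measure_mono_fmeasurable)
    show "(\<Union>i\<in>I. {W (u i)<..<W (v i)}) \<subseteq> {W p..W q}"
    proof safe
      fix i x assume i: "i \<in> I" and x: "x \<in> {W (u i)<..<W (v i)}"
      have "W p \<le> W (u i)" "W (v i) \<le> W q" using uv[OF i] by (auto intro: le)
      then show "x \<in> {W p..W q}" using x by auto
    qed
    show "{W p..W q} \<in> fmeasurable lborel"
      using \<open>p \<le> q\<close> by (intro fmeasurableI) (auto simp: le)
  qed (use I in auto)
  also have "\<dots> = W q - W p" using \<open>p \<le> q\<close> by (simp add: le)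
  finally show ?thesis .
qed

text \<open>The Vitali covering estimate: the intervals on which \<open>W\<close> has slope at least \<open>\<alpha>\<close> cover \<open>S\<close> finely,
and disjoint ones among them have total length at most \<open>(W q - W p) / \<alpha>\<close>. The set \<open>T\<close> witnesses the bound on
the outer measure, as \<open>S\<close> need not be measurable.\<close>

lemma mono_increments_outer_measure:
  fixes W :: "real \<Rightarrow> real"
  assumes W: "mono_on {p..q} W" and "p \<le> q" and "\<alpha> > 0"
    and S: "\<And>x d. x \<in> S \<Longrightarrow> d > 0 \<Longrightarrow>
        \<exists>u v. p \<le> u \<and> u < v \<and> v \<le> q \<and> u \<le> x \<and> x \<le> v \<and> v - u < d \<and> \<alpha> * (v - u) \<le> W v - W u"
  obtains T where "S \<subseteq> T" "T \<in> lmeasurable" "measure lebesgue T \<le> (W q - W p) / \<alpha>"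
proof -
  define K where "K = {(u, v). p \<le> u \<and> u < v \<and> v \<le> q \<and> \<alpha> * (v - u) \<le> W v - W u}"
  define c where "c = (\<lambda>(u, v). (u + v) / 2 :: real)"
  define r where "r = (\<lambda>(u, v). (v - u) / 2 :: real)"
  have cb: "cball (c i) (r i) = {fst i..snd i}" for i
    by (cases i) (auto simp: c_def r_def cball_eq_atLeastAtMost field_simps)
  obtain C where C: "countable C" "C \<subseteq> K"
     "pairwise (\<lambda>i j. disjnt (cball (c i) (r i)) (cball (c j) (r j))) C"
     "negligible (S - (\<Union>i \<in> C. cball (c i) (r i)))"
  proof (rule Vitali_covering_theorem_cballs[of K r S c])
    show "0 < r i" if "i \<in> K" for i using that by (auto simp: K_def r_def)
    fix x d :: real assume x: "x \<in> S" and d: "0 < d"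
    from S[OF this] obtain u v where "p \<le> u" "u < v" "v \<le> q" "u \<le> x" "x \<le> v"
      "v - u < d" "\<alpha> * (v - u) \<le> W v - W u" by blast
    then show "\<exists>i. i \<in> K \<and> x \<in> cball (c i) (r i) \<and> r i < d"
      unfolding cb by (intro exI[of _ "(u, v)"]) (auto simp: K_def r_def)
  qed
  have bound: "measure lebesgue (\<Union>i\<in>I. cball (c i) (r i)) \<le> (W q - W p) / \<alpha>"
    if I: "I \<subseteq> C" "finite I" for I
  proof -
    have "measure lebesgue (\<Union>i\<in>I. cball (c i) (r i)) \<le> (\<Sum>i\<in>I. measure lebesgue (cball (c i) (r i)))"
      using I by (intro measure_UNION_le) auto
    also have "\<dots> = (\<Sum>i\<in>I. snd i - fst i)"
      using I C(2) unfolding cb by (intro sum.cong refl) (auto simp: K_def)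
    also have "\<dots> \<le> (\<Sum>i\<in>I. (W (snd i) - W (fst i)) / \<alpha>)"
      using I C(2) \<open>\<alpha> > 0\<close> by (intro sum_mono) (force simp: K_def field_simps)
    also have "\<dots> = (\<Sum>i\<in>I. W (snd i) - W (fst i)) / \<alpha>"
      by (simp add: sum_divide_distrib)
    also have "\<dots> \<le> (W q - W p) / \<alpha>"
    proof (intro divide_right_mono sum_increments_le[OF W])
      show "disjoint_family_on (\<lambda>i. {fst i<..<snd i}) I"
        unfolding disjoint_family_on_def
      proof (intro ballI impI)
        fix i j assume "i \<in> I" "j \<in> I" "i \<noteq> j"
        then have "{fst i..snd i} \<inter> {fst j..snd j} = {}"
          using C(3) I unfolding cb pairwise_def disjnt_def by blast
        then show "{fst i<..<snd i} \<inter> {fst j<..<snd j} = {}"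
          by (meson disjoint_iff greaterThanLessThan_iff atLeastAtMost_iff less_imp_le)
      qed
    qed (use I C(2) \<open>\<alpha> > 0\<close> \<open>p \<le> q\<close> in \<open>auto simp: K_def\<close>)
    finally show ?thesis .
  qed
  let ?T = "\<Union>i\<in>C. cball (c i) (r i)"
  have T: "?T \<in> lmeasurable" "measure lebesgue ?T \<le> (W q - W p) / \<alpha>"
    by (rule fmeasurable_UN_bound[OF C(1) _ bound] measure_UN_bound[OF C(1) _ bound]; simp)+
  have N: "S - ?T \<in> lmeasurable" "measure lebesgue (S - ?T) = 0"
    using C(4) by (auto simp: negligible_iff_measure)
  have "measure lebesgue (?T \<union> (S - ?T)) \<le> measure lebesgue ?T + measure lebesgue (S - ?T)"
    using T N by (intro measure_Un_le) (auto dest: fmeasurableD)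
  moreover have "?T \<union> (S - ?T) \<in> lmeasurable" using T(1) N(1) by (rule fmeasurable.Un)
  ultimately show thesis
    using T(2) N(2) by (intro that[of "?T \<union> (S - ?T)"]) (blast, assumption, linarith)
qed

text \<open>For points of the open interval, the requirement that the short intervals lie in \<open>[p, q]\<close> is
automatic.\<close>

lemma mono_increments_outer_measure_interior:
  fixes W :: "real \<Rightarrow> real"
  assumes W: "mono_on {p..q} W" and "p \<le> q" and "\<alpha> > 0" and "S \<subseteq> {p<..<q}"
    and S: "\<And>x d. x \<in> S \<Longrightarrow> d > 0 \<Longrightarrow>
        \<exists>u v. u < v \<and> u \<le> x \<and> x \<le> v \<and> v - u < d \<and>
          (p \<le> u \<and> v \<le> q \<longrightarrow> \<alpha> * (v - u) \<le> W v - W u)"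
  obtains T where "S \<subseteq> T" "T \<in> lmeasurable" "measure lebesgue T \<le> (W q - W p) / \<alpha>"
proof (rule mono_increments_outer_measure[OF W \<open>p \<le> q\<close> \<open>\<alpha> > 0\<close>])
  fix x d :: real assume x: "x \<in> S" and "d > 0"
  \<comment> \<open>an interval through \<open>x\<close> shorter than this stays inside \<open>[p, q]\<close>\<close>
  then have "min d (min (x - p) (q - x)) > 0" using \<open>S \<subseteq> {p<..<q}\<close> by auto
  from S[OF x this] obtain u v where uv: "u < v" "u \<le> x" "x \<le> v" "v - u < min d (min (x - p) (q - x))"
    "p \<le> u \<and> v \<le> q \<longrightarrow> \<alpha> * (v - u) \<le> W v - W u"
    by blast
  then have "p \<le> u" "v \<le> q" "v - u < d" by linarith+
  with uv show "\<exists>u v. p \<le> u \<and> u < v \<and> v \<le> q \<and> u \<le> x \<and> x \<le> v \<and> v - u < d \<and> \<alpha> * (v - u) \<le> W v - W u"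
    by blast
qed

section \<open>Variation\<close>

lemma division_of_realD:
  fixes d :: "real set set"
  assumes "d division_of {p..q}"
  shows "finite d"
    and "\<And>k. k \<in> d \<Longrightarrow> k = {Inf k..Sup k} \<and> p \<le> Inf k \<and> Inf k \<le> Sup k \<and> Sup k \<le> q"
    and "disjoint_family_on (\<lambda>k. {Inf k<..<Sup k}) d"
proof -
  show "finite d" using assms by (rule division_ofD(1))
  show *: "k = {Inf k..Sup k} \<and> p \<le> Inf k \<and> Inf k \<le> Sup k \<and> Sup k \<le> q" if "k \<in> d" for k
  proof -
    obtain u v where k: "k = cbox u v" using division_ofD(4)[OF assms \<open>k \<in> d\<close>] by blast
    moreover have "k \<noteq> {}" "k \<subseteq> {p..q}"
      using division_ofD(2,3)[OF assms that] by simp_all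
    ultimately show ?thesis by auto
  qed
  show "disjoint_family_on (\<lambda>k. {Inf k<..<Sup k}) d"
    unfolding disjoint_family_on_def
  proof (intro ballI impI)
    fix k l assume kl: "k \<in> d" "l \<in> d" "k \<noteq> l"
    have "interior k = {Inf k<..<Sup k}" "interior l = {Inf l<..<Sup l}"
      using arg_cong[OF conjunct1[OF *[OF kl(1)]], of interior]
        arg_cong[OF conjunct1[OF *[OF kl(2)]], of interior] interior_atLeastAtMost_real by simp_all
    moreover have "interior k \<inter> interior l = {}" using division_ofD(5)[OF assms kl] .
    ultimately show "{Inf k<..<Sup k} \<inter> {Inf l<..<Sup l} = {}" by simp
  qed
qed

lemma division_extend_right:
  fixes p u v :: real and F :: "real set \<Rightarrow> real"
  assumes d: "d division_of {p..u}" and "p \<le> u" "u < v"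
  shows "insert {u..v} d division_of {p..v}"
    and "sum F (insert {u..v} d) = F {u..v} + sum F d"
proof -
  have "{ {u..v} } division_of {u..v}"
    using \<open>u < v\<close> division_of_self[of u v] by simp
  from division_disjoint_union[OF d this]
  have "d \<union> { {u..v} } division_of ({p..u} \<union> {u..v})" by force
  moreover have "{p..u} \<union> {u..v} = {p..v}" using assms by auto
  ultimately show "insert {u..v} d division_of {p..v}" by simp
  have "{u..v} \<notin> d" using division_of_realD(2)[OF d, of "{u..v}"] \<open>u < v\<close> by auto
  then show "sum F (insert {u..v} d) = F {u..v} + sum F d"
    using division_of_realD(1)[OF d] by simp
qed

text \<open>The function \<open>V x\<close> is the total variation of \<open>g\<close> on \<open>[p, x]\<close>; only two of its properties are needed,
that its increments dominate those of \<open>g\<close> and that \<open>V q - V p\<close> is approximated by divisions.\<close>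

lemma bounded_variation_dominating_function:
  fixes g :: "real \<Rightarrow> real"
  assumes "p \<le> q"
    and B: "\<And>d. d division_of {p..q} \<Longrightarrow> (\<Sum>k\<in>d. \<bar>g (Sup k) - g (Inf k)\<bar>) \<le> B"
  obtains V where "\<And>u v. \<lbrakk>p \<le> u; u \<le> v; v \<le> q\<rbrakk> \<Longrightarrow> \<bar>g v - g u\<bar> \<le> V v - V u"
    and "\<And>e. e > 0 \<Longrightarrow> \<exists>d. d division_of {p..q} \<and> V q - V p - e < (\<Sum>k\<in>d. \<bar>g (Sup k) - g (Inf k)\<bar>)"
proof
  define var where "var = (\<lambda>d. \<Sum>k\<in>d. \<bar>g (Sup k) - g (Inf k)\<bar>)"
  define D where "D = (\<lambda>x. {d. d division_of {p..x}})"
  define V where "V = (\<lambda>x. SUP d\<in>D x. var d)"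
  have ne: "D x \<noteq> {}" if "p \<le> x" for x
    using division_of_self[of p x] that by (auto simp: D_def)
  have ext: "insert {u..v} d \<in> D v" "var (insert {u..v} d) = \<bar>g v - g u\<bar> + var d"
    if "p \<le> u" "u < v" "d \<in> D u" for d u v
    using division_extend_right(1)[of d p u v] that
      division_extend_right(2)[of d p u v "\<lambda>k. \<bar>g (Sup k) - g (Inf k)\<bar>"]
    by (auto simp: D_def var_def)
  have bdd: "bdd_above (var ` D x)" if "p \<le> x" "x \<le> q" for x
  proof (rule bdd_aboveI2)
    fix d assume d: "d \<in> D x"
    show "var d \<le> B"
    proof (cases "x = q")
      case True then show ?thesis using d B by (simp add: D_def var_def)
    next
      case False
      then have "var (insert {x..q} d) \<le> B"
        using ext(1)[OF that(1) _ d, of q] that B by (simp add: D_def var_def)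
      then show ?thesis using ext(2)[OF that(1) _ d, of q] that False by simp
    qed
  qed
  show "\<bar>g v - g u\<bar> \<le> V v - V u" if "p \<le> u" "u \<le> v" "v \<le> q" for u v
  proof (cases "u = v")
    case False
    with that have "u < v" by simp
    have "V u \<le> V v - \<bar>g v - g u\<bar>"
      unfolding V_def
    proof (rule cSUP_least[OF ne[OF that(1)]])
      fix d assume d: "d \<in> D u"
      have "var (insert {u..v} d) \<le> (SUP d\<in>D v. var d)"
        using that by (intro cSUP_upper ext(1)[OF that(1) \<open>u < v\<close> d] bdd) auto
      then show "var d \<le> (SUP d\<in>D v. var d) - \<bar>g v - g u\<bar>"
        using ext(2)[OF that(1) \<open>u < v\<close> d] by simp
    qed
    then show ?thesis by simp
  qed simp
  have "V p \<ge> 0"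
    unfolding V_def
  proof (rule cSUP_upper2[OF bdd])
    show "{ {p..p} } \<in> D p" using division_of_self[of p p] by (simp add: D_def)
  qed (use \<open>p \<le> q\<close> in \<open>auto simp: var_def\<close>)
  fix e :: real assume "e > 0"
  then have "V q - V p - e < (SUP d\<in>D q. var d)"
    using \<open>V p \<ge> 0\<close> by (simp add: V_def)
  then obtain d where "d \<in> D q" "V q - V p - e < var d"
    using less_cSUP_iff[OF ne[OF \<open>p \<le> q\<close>] bdd] \<open>p \<le> q\<close> by blast
  then show "\<exists>d. d division_of {p..q} \<and> V q - V p - e < (\<Sum>k\<in>d. \<bar>g (Sup k) - g (Inf k)\<bar>)"
    by (auto simp: D_def var_def)
qed

section \<open>Almost everywhere differentiability\<close>

text \<open>Almost everywhere the difference quotients of a function of bounded variation are bounded.\<close>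

lemma bounded_variation_steep_negligible:
  fixes g :: "real \<Rightarrow> real"
  assumes "p \<le> q"
    and B: "\<And>d. d division_of {p..q} \<Longrightarrow> (\<Sum>k\<in>d. \<bar>g (Sup k) - g (Inf k)\<bar>) \<le> B"
    and S: "S \<subseteq> {p<..<q}"
    and steep: "\<And>x K d. x \<in> S \<Longrightarrow> d > 0 \<Longrightarrow>
        \<exists>u v. u < v \<and> u \<le> x \<and> x \<le> v \<and> v - u < d \<and> K * (v - u) \<le> \<bar>g v - g u\<bar>"
  shows "negligible S"
proof -
  obtain V where V: "\<And>u v. \<lbrakk>p \<le> u; u \<le> v; v \<le> q\<rbrakk> \<Longrightarrow> \<bar>g v - g u\<bar> \<le> V v - V u"
    by (rule bounded_variation_dominating_function[OF \<open>p \<le> q\<close> B]) blast+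
  have mono: "mono_on {p..q} V"
    by (rule mono_onI) (use V in fastforce)
  show ?thesis
    unfolding negligible_outer_le
  proof (intro allI impI)
    fix e :: real assume "e > 0"
    \<comment> \<open>the summand 1 keeps \<open>K\<close> positive when \<open>V\<close> is constant\<close>
    define K where "K = (V q - V p + 1) / e"
    have "V q - V p \<ge> 0" using V[of p q] \<open>p \<le> q\<close> by simp
    then have "K > 0" "(V q - V p) / K \<le> e"
      using \<open>e > 0\<close> by (auto simp: K_def divide_simps)
    obtain T where "S \<subseteq> T" "T \<in> lmeasurable" "measure lebesgue T \<le> (V q - V p) / K"
    proof (rule mono_increments_outer_measure_interior[OF mono \<open>p \<le> q\<close> \<open>K > 0\<close> S])
      fix x d :: real assume "x \<in> S" "d > 0"
      from steep[OF this, of K] obtain u v where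
        uv: "u < v" "u \<le> x" "x \<le> v" "v - u < d" "K * (v - u) \<le> \<bar>g v - g u\<bar>" by blast
      have "K * (v - u) \<le> V v - V u" if "p \<le> u" "v \<le> q"
        using V[of u v] uv that by linarith
      with uv show "\<exists>u v. u < v \<and> u \<le> x \<and> x \<le> v \<and> v - u < d \<and>
          (p \<le> u \<and> v \<le> q \<longrightarrow> K * (v - u) \<le> V v - V u)"
        by blast
    qed
    then show "\<exists>T. S \<subseteq> T \<and> T \<in> lmeasurable \<and> measure lebesgue T \<le> e"
      using \<open>(V q - V p) / K \<le> e\<close> by (meson order_trans)
  qed
qed

text \<open>The set where slopes of at least \<open>\<alpha>\<close> and of at most \<open>-\<alpha>\<close> both occur over arbitrarily short intervals
is null. The general case of two different slopes \<open>r < s\<close> reduces to this one by subtracting a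
linear function.\<close>

lemma bounded_variation_oscillation_negligible:
  fixes g :: "real \<Rightarrow> real"
  assumes "p \<le> q"
    and B: "\<And>d. d division_of {p..q} \<Longrightarrow> (\<Sum>k\<in>d. \<bar>g (Sup k) - g (Inf k)\<bar>) \<le> B"
    and S: "S \<subseteq> {p<..<q}" and "\<alpha> > 0"
    and up: "\<And>x d. x \<in> S \<Longrightarrow> d > 0 \<Longrightarrow>
        \<exists>u v. u < v \<and> u \<le> x \<and> x \<le> v \<and> v - u < d \<and> \<alpha> * (v - u) \<le> g v - g u"
    and down: "\<And>x d. x \<in> S \<Longrightarrow> d > 0 \<Longrightarrow>
        \<exists>u v. u < v \<and> u \<le> x \<and> x \<le> v \<and> v - u < d \<and> \<alpha> * (v - u) \<le> g u - g v"
  shows "negligible S"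
proof -
  obtain V where V: "\<And>u v. \<lbrakk>p \<le> u; u \<le> v; v \<le> q\<rbrakk> \<Longrightarrow> \<bar>g v - g u\<bar> \<le> V v - V u"
    and sharp: "\<And>e. e > 0 \<Longrightarrow> \<exists>d. d division_of {p..q} \<and> V q - V p - e < (\<Sum>k\<in>d. \<bar>g (Sup k) - g (Inf k)\<bar>)"
    using bounded_variation_dominating_function[OF \<open>p \<le> q\<close> B] by blast
  have mono: "mono_on {p..q} V"
    by (rule mono_onI) (use V in fastforce)
  show ?thesis
    unfolding negligible_outer_le
  proof (intro allI impI)
    fix e :: real assume "e > 0"
    obtain d where d: "d division_of {p..q}" and dV: "V q - V p - e * \<alpha> < (\<Sum>k\<in>d. \<bar>g (Sup k) - g (Inf k)\<bar>)"
      using sharp[of "e * \<alpha>"] \<open>e > 0\<close> \<open>\<alpha> > 0\<close> by auto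
    note dD = division_of_realD[OF d]
    have "\<exists>T. S \<inter> {Inf k<..<Sup k} \<subseteq> T \<and> T \<in> lmeasurable \<and>
        measure lebesgue T \<le> (V (Sup k) - V (Inf k) - \<bar>g (Sup k) - g (Inf k)\<bar>) / \<alpha>" if k: "k \<in> d" for k
    proof -
      \<comment> \<open>\<open>s\<close> is the sign of the increment of \<open>g\<close> over \<open>k\<close>, so that \<open>V - s * g\<close> gains little over \<open>k\<close>\<close>
      define s :: real where "s = (if g (Inf k) \<le> g (Sup k) then 1 else - 1)"
      define W where "W = (\<lambda>x. V x - s * g x)"
      have kk: "p \<le> Inf k" "Inf k \<le> Sup k" "Sup k \<le> q" using dD(2)[OF k] by auto
      have "s * g v - s * g u \<le> \<bar>g v - g u\<bar>" for u v by (auto simp: s_def)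
      then have monoW: "mono_on {Inf k..Sup k} W"
        using V kk unfolding W_def by (intro mono_onI) (smt (verit) atLeastAtMost_iff)
      have Wk: "W (Sup k) - W (Inf k) = V (Sup k) - V (Inf k) - \<bar>g (Sup k) - g (Inf k)\<bar>"
        by (simp add: W_def s_def)
      obtain T where "S \<inter> {Inf k<..<Sup k} \<subseteq> T" "T \<in> lmeasurable"
        "measure lebesgue T \<le> (W (Sup k) - W (Inf k)) / \<alpha>"
      proof (rule mono_increments_outer_measure_interior[OF monoW kk(2) \<open>\<alpha> > 0\<close>])
        fix x \<delta> :: real assume x: "x \<in> S \<inter> {Inf k<..<Sup k}" and "\<delta> > 0"
        \<comment> \<open>slopes whose sign is opposite to \<open>s\<close>\<close>
        have "\<exists>u v. u < v \<and> u \<le> x \<and> x \<le> v \<and> v - u < \<delta> \<and> \<alpha> * (v - u) \<le> s * g u - s * g v"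
          using up[of x \<delta>] down[of x \<delta>] x \<open>\<delta> > 0\<close> by (auto simp: s_def)
        then obtain u v where uv: "u < v" "u \<le> x" "x \<le> v" "v - u < \<delta>" "\<alpha> * (v - u) \<le> s * g u - s * g v"
          by blast
        have "\<alpha> * (v - u) \<le> W v - W u" if "Inf k \<le> u" "v \<le> Sup k"
          using V[of u v] uv that kk by (auto simp: W_def)
        with uv show "\<exists>u v. u < v \<and> u \<le> x \<and> x \<le> v \<and> v - u < \<delta> \<and>
            (Inf k \<le> u \<and> v \<le> Sup k \<longrightarrow> \<alpha> * (v - u) \<le> W v - W u)"
          by blast
      qed auto
      then show ?thesis unfolding Wk by blast
    qed
    then obtain T where T: "\<And>k. k \<in> d \<Longrightarrow> S \<inter> {Inf k<..<Sup k} \<subseteq> T k" "\<And>k. k \<in> d \<Longrightarrow> T k \<in> lmeasurable"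
       "\<And>k. k \<in> d \<Longrightarrow> measure lebesgue (T k) \<le> (V (Sup k) - V (Inf k) - \<bar>g (Sup k) - g (Inf k)\<bar>) / \<alpha>"
      by metis
    \<comment> \<open>the endpoints of the division are not covered by the sets \<open>T k\<close>\<close>
    define E where "E = Inf ` d \<union> Sup ` d"
    have "finite E" using dD(1) by (simp add: E_def)
    then have E: "E \<in> lmeasurable" "measure lebesgue E = 0"
      using negligible_finite[of E] by (auto simp: negligible_iff_measure)
    have UT: "(\<Union>k\<in>d. T k) \<in> lmeasurable" using T(2) dD(1) by (intro fmeasurable.finite_UN) auto
    have "S \<subseteq> E \<union> (\<Union>k\<in>d. T k)"
    proof
      fix x assume x: "x \<in> S"
      then obtain k where k: "k \<in> d" "x \<in> k" using d S by fastforce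
      then have "x \<in> {Inf k..Sup k}" using dD(2)[OF k(1)] by blast
      then consider "x = Inf k" | "x = Sup k" | "x \<in> {Inf k<..<Sup k}" by force
      then show "x \<in> E \<union> (\<Union>k\<in>d. T k)"
        using k x T(1)[OF k(1)] by cases (auto simp: E_def)
    qed
    moreover have "E \<union> (\<Union>k\<in>d. T k) \<in> lmeasurable" using E(1) UT by (rule fmeasurable.Un)
    moreover have "measure lebesgue (E \<union> (\<Union>k\<in>d. T k)) \<le> e"
    proof -
      have "measure lebesgue (E \<union> (\<Union>k\<in>d. T k)) \<le> measure lebesgue E + measure lebesgue (\<Union>k\<in>d. T k)"
        using E(1) UT by (intro measure_Un_le) (auto dest: fmeasurableD)
      also have "\<dots> \<le> (\<Sum>k\<in>d. measure lebesgue (T k))"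
        using E(2) dD(1) T(2) by (simp add: measure_UNION_le fmeasurableD)
      also have "\<dots> \<le> (\<Sum>k\<in>d. (V (Sup k) - V (Inf k) - \<bar>g (Sup k) - g (Inf k)\<bar>) / \<alpha>)"
        using T(3) by (rule sum_mono)
      also have "\<dots> = ((\<Sum>k\<in>d. V (Sup k) - V (Inf k)) - (\<Sum>k\<in>d. \<bar>g (Sup k) - g (Inf k)\<bar>)) / \<alpha>"
        by (simp add: sum_divide_distrib[symmetric] sum_subtractf)
      also have "\<dots> \<le> (e * \<alpha>) / \<alpha>"
      proof (rule divide_right_mono)
        have "(\<Sum>k\<in>d. V (Sup k) - V (Inf k)) \<le> V q - V p"
          using dD(2) by (intro sum_increments_le[OF mono \<open>p \<le> q\<close> dD(1) _ dD(3)]) auto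
        then show "(\<Sum>k\<in>d. V (Sup k) - V (Inf k)) - (\<Sum>k\<in>d. \<bar>g (Sup k) - g (Inf k)\<bar>) \<le> e * \<alpha>"
          using dV by linarith
      qed (use \<open>\<alpha> > 0\<close> in simp)
      finally show ?thesis using \<open>\<alpha> > 0\<close> by simp
    qed
    ultimately show "\<exists>T. S \<subseteq> T \<and> T \<in> lmeasurable \<and> measure lebesgue T \<le> e" by blast
  qed
qed

lemma tendsto_if_no_rational_oscillation:
  fixes f :: "'a \<Rightarrow> real"
  assumes "F \<noteq> bot" and bdd: "eventually (\<lambda>x. \<bar>f x\<bar> \<le> K) F"
    and osc: "\<And>r s. r \<in> \<rat> \<Longrightarrow> s \<in> \<rat> \<Longrightarrow> r < s \<Longrightarrow> \<exists>\<^sub>F x in F. f x < r \<Longrightarrow> \<exists>\<^sub>F x in F. s < f x \<Longrightarrow> False"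
  obtains L where "(f \<longlongrightarrow> L) F"
proof -
  define X where "X = (\<lambda>x. ereal (f x))"
  have le: "Liminf F X \<le> Limsup F X" using \<open>F \<noteq> bot\<close> by (rule Liminf_le_Limsup)
  have "Liminf F X = Limsup F X"
  proof (rule ccontr)
    assume "Liminf F X \<noteq> Limsup F X"
    with le have lt: "Liminf F X < Limsup F X" by simp
    then obtain c where c: "Liminf F X < ereal c" "ereal c < Limsup F X" using ereal_dense2 by blast
    from c(1) obtain r' where r': "Liminf F X < ereal r'" "ereal r' < ereal c" using ereal_dense2 by blast
    have "r' < c" using r'(2) by simp
    from Rats_dense_in_real[OF this] obtain r where r: "r \<in> \<rat>" "r' < r" "r < c" by blast
    from c(2) obtain s' where s': "ereal c < ereal s'" "ereal s' < Limsup F X" using ereal_dense2 by blast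
    have "c < s'" using s'(1) by simp
    from Rats_dense_in_real[OF this] obtain s where s: "s \<in> \<rat>" "c < s" "s < s'" by blast
    have "\<exists>\<^sub>F x in F. f x < r"
    proof (rule ccontr)
      assume "\<not> (\<exists>\<^sub>F x in F. f x < r)"
      then have ev: "eventually (\<lambda>x. r \<le> f x) F" by (simp add: frequently_def not_less)
      have "ereal r' \<le> Liminf F X"
        by (rule Liminf_bounded, rule eventually_mono[OF ev]) (use r in \<open>auto simp: X_def\<close>)
      with r' show False by simp
    qed
    moreover have "\<exists>\<^sub>F x in F. s < f x"
    proof (rule ccontr)
      assume "\<not> (\<exists>\<^sub>F x in F. s < f x)"
      then have ev: "eventually (\<lambda>x. f x \<le> s) F" by (simp add: frequently_def not_less)
      have "Limsup F X \<le> ereal s'"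
        by (rule Limsup_bounded, rule eventually_mono[OF ev]) (use s in \<open>auto simp: X_def\<close>)
      with s' show False by simp
    qed
    ultimately show False using osc[of r s] r s by auto
  qed
  then have lim: "(X \<longlongrightarrow> Limsup F X) F"
    using \<open>F \<noteq> bot\<close> by (intro Liminf_eq_Limsup) auto
  have "Limsup F X \<le> ereal K"
    by (rule Limsup_bounded, rule eventually_mono[OF bdd]) (auto simp: X_def)
  moreover have "ereal (- K) \<le> Liminf F X"
    by (rule Liminf_bounded, rule eventually_mono[OF bdd]) (auto simp: X_def)
  ultimately obtain L where "Limsup F X = ereal L"
    using le by (cases "Limsup F X") auto
  with lim show thesis by (intro that[of L]) (simp add: X_def)
qed

text \<open>Where \<open>g\<close> is not differentiable, its difference quotients are unbounded or oscillate across two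
rationals \<open>r < s\<close>; the latter points form a countable union of null sets.\<close>

lemma bounded_variation_differentiable_ae:
  fixes g :: "real \<Rightarrow> real"
  assumes "p \<le> q"
    and B: "\<And>d. d division_of {p..q} \<Longrightarrow> (\<Sum>k\<in>d. \<bar>g (Sup k) - g (Inf k)\<bar>) \<le> B"
  shows "negligible {x \<in> {p<..<q}. \<not> g differentiable (at x)}"
proof -
  define Q where "Q = (\<lambda>x y. (g y - g x) / (y - x))"
  have Q: "g (max x y) - g (min x y) = Q x y * (max x y - min x y)" if "y \<noteq> x" for x y
    using that by (auto simp: Q_def max_def min_def field_simps)
  have near: "\<exists>u v t. u < v \<and> u \<le> x \<and> x \<le> v \<and> v - u < d \<and> g v - g u = t * (v - u) \<and> P t"
    if freq: "\<exists>\<^sub>F y in at x. P (Q x y)" and "d > 0" for x d P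
  proof -
    obtain y where y: "y \<noteq> x" "dist y x < d" "P (Q x y)"
      using freq \<open>d > 0\<close> unfolding frequently_at by blast
    have "min x y < max x y" "min x y \<le> x" "x \<le> max x y" "max x y - min x y < d"
      using y by (auto simp: dist_real_def)
    then show ?thesis using Q[OF y(1)] y(3) by blast
  qed
  define Z where "Z = {x \<in> {p<..<q}. \<forall>K. \<exists>\<^sub>F y in at x. \<bar>Q x y\<bar> > K}"
  define E where "E = (\<lambda>(r, s). {x \<in> {p<..<q}. r < s \<and> (\<exists>\<^sub>F y in at x. Q x y < r) \<and> (\<exists>\<^sub>F y in at x. s < Q x y)})"
  have "negligible Z"
  proof (rule bounded_variation_steep_negligible[OF \<open>p \<le> q\<close> B])
    fix x K d :: real assume "x \<in> Z" "d > 0"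
    then have "\<exists>\<^sub>F y in at x. \<bar>Q x y\<bar> > K" by (simp add: Z_def)
    from near[OF this \<open>d > 0\<close>] obtain u v t where uv: "u < v" "u \<le> x" "x \<le> v" "v - u < d"
      "g v - g u = t * (v - u)" "K < \<bar>t\<bar>" by blast
    have "K * (v - u) \<le> \<bar>g v - g u\<bar>" using uv by (simp add: abs_mult)
    with uv show "\<exists>u v. u < v \<and> u \<le> x \<and> x \<le> v \<and> v - u < d \<and> K * (v - u) \<le> \<bar>g v - g u\<bar>" by blast
  qed (auto simp: Z_def)
  moreover have negE: "negligible (E (r, s))" for r s
  proof (cases "r < s")
    case True
    \<comment> \<open>subtracting the mean slope makes the two slopes \<open>r\<close>, \<open>s\<close> opposite\<close>
    define m where "m = (r + s) / 2"
    define h where "h = (\<lambda>x. g x - m * x)"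
    show ?thesis
    proof (rule bounded_variation_oscillation_negligible[OF \<open>p \<le> q\<close>])
      fix d assume d: "d division_of {p..q}"
      note dD = division_of_realD[OF d]
      have "(\<Sum>k\<in>d. \<bar>h (Sup k) - h (Inf k)\<bar>) \<le> (\<Sum>k\<in>d. \<bar>g (Sup k) - g (Inf k)\<bar> + \<bar>m\<bar> * (Sup k - Inf k))"
      proof (rule sum_mono)
        fix k assume "k \<in> d"
        then have "\<bar>m * (Sup k - Inf k)\<bar> = \<bar>m\<bar> * (Sup k - Inf k)" using dD(2) by (simp add: abs_mult)
        moreover have "h (Sup k) - h (Inf k) = (g (Sup k) - g (Inf k)) - m * (Sup k - Inf k)"
          by (simp add: h_def algebra_simps)
        ultimately show "\<bar>h (Sup k) - h (Inf k)\<bar> \<le> \<bar>g (Sup k) - g (Inf k)\<bar> + \<bar>m\<bar> * (Sup k - Inf k)"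
          by linarith
      qed
      also have "\<dots> = (\<Sum>k\<in>d. \<bar>g (Sup k) - g (Inf k)\<bar>) + \<bar>m\<bar> * (\<Sum>k\<in>d. Sup k - Inf k)"
        by (simp add: sum.distrib sum_distrib_left)
      also have "\<dots> \<le> B + \<bar>m\<bar> * (q - p)"
        using dD \<open>p \<le> q\<close> by (intro add_mono B d mult_left_mono sum_increments_le[where W = "\<lambda>x. x"]) (auto simp: mono_on_def)
      finally show "(\<Sum>k\<in>d. \<bar>h (Sup k) - h (Inf k)\<bar>) \<le> B + \<bar>m\<bar> * (q - p)" .
    next
      show "E (r, s) \<subseteq> {p<..<q}" by (auto simp: E_def)
      show "(s - r) / 2 > 0" using True by simp
    next
      fix x d :: real assume "x \<in> E (r, s)" "d > 0"
      then have "\<exists>\<^sub>F y in at x. s < Q x y" by (simp add: E_def)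
      from near[OF this \<open>d > 0\<close>] obtain u v t where uv: "u < v" "u \<le> x" "x \<le> v" "v - u < d"
        "g v - g u = t * (v - u)" "s < t" by blast
      have "(s - m) * (v - u) \<le> (t - m) * (v - u)" using uv by (intro mult_right_mono) auto
      also have "\<dots> = h v - h u" using uv(5) by (simp add: h_def algebra_simps)
      also have "s - m = (s - r) / 2" by (simp add: m_def field_simps)
      finally show "\<exists>u v. u < v \<and> u \<le> x \<and> x \<le> v \<and> v - u < d \<and> (s - r) / 2 * (v - u) \<le> h v - h u"
        using uv by blast
    next
      fix x d :: real assume "x \<in> E (r, s)" "d > 0"
      then have "\<exists>\<^sub>F y in at x. Q x y < r" by (simp add: E_def)
      from near[OF this \<open>d > 0\<close>] obtain u v t where uv: "u < v" "u \<le> x" "x \<le> v" "v - u < d"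
        "g v - g u = t * (v - u)" "t < r" by blast
      have "(m - r) * (v - u) \<le> (m - t) * (v - u)" using uv by (intro mult_right_mono) auto
      also have "\<dots> = h u - h v" using uv(5) by (simp add: h_def algebra_simps)
      also have "m - r = (s - r) / 2" by (simp add: m_def field_simps)
      finally show "\<exists>u v. u < v \<and> u \<le> x \<and> x \<le> v \<and> v - u < d \<and> (s - r) / 2 * (v - u) \<le> h u - h v"
        using uv by blast
    qed
  qed (simp add: E_def)
  have "negligible (\<Union>(E ` (\<rat> \<times> \<rat>)))"
    by (intro negligible_countable_Union) (use negE countable_rat in auto)
  ultimately have "negligible (Z \<union> \<Union>(E ` (\<rat> \<times> \<rat>)))" by (rule negligible_Un)
  moreover have "{x \<in> {p<..<q}. \<not> g differentiable (at x)} \<subseteq> Z \<union> \<Union>(E ` (\<rat> \<times> \<rat>))"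
  proof (rule subsetI, rule ccontr)
    fix x assume x: "x \<in> {x \<in> {p<..<q}. \<not> g differentiable (at x)}" and "x \<notin> Z \<union> \<Union>(E ` (\<rat> \<times> \<rat>))"
    then have nZ: "x \<notin> Z" and nE: "\<And>r s. r \<in> \<rat> \<Longrightarrow> s \<in> \<rat> \<Longrightarrow> x \<notin> E (r, s)" by auto
    obtain K where K: "\<forall>\<^sub>F y in at x. \<bar>Q x y\<bar> \<le> K"
      using nZ x by (auto simp: Z_def frequently_def not_less)
    have "False" if "r \<in> \<rat>" "s \<in> \<rat>" "r < s" "\<exists>\<^sub>F y in at x. Q x y < r" "\<exists>\<^sub>F y in at x. s < Q x y" for r s
      using nE[OF that(1,2)] that x by (simp add: E_def)
    then obtain L where "(Q x \<longlongrightarrow> L) (at x)"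
      using tendsto_if_no_rational_oscillation[OF _ K] by (metis at_neq_bot)
    then have "(g has_field_derivative L) (at x)"
      by (simp add: has_field_derivative_iff Q_def)
    then show False using x by (auto simp: real_differentiable_def)
  qed
  ultimately show ?thesis by (rule negligible_subset)
qed

lemma absolutely_continuous_locally_bounded_variation:
  assumes "absolutely_continuous_on S g"
  obtains \<delta> where "\<delta> > 0"
    and "\<And>p q d. {p..q} \<subseteq> S \<Longrightarrow> p \<le> q \<Longrightarrow> q - p < \<delta> \<Longrightarrow> d division_of {p..q} \<Longrightarrow>
        (\<Sum>k\<in>d. \<bar>g (Sup k) - g (Inf k)\<bar>) \<le> 1"
proof -
  obtain \<delta> where "\<delta> > 0" and \<delta>: "\<And>(I :: real set set) u v. \<lbrakk>finite I; \<And>i. i \<in> I \<Longrightarrow> u i \<le> v i \<and> {u i..v i} \<subseteq> S;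
           disjoint_family_on (\<lambda>i. {u i<..<v i}) I; (\<Sum>i\<in>I. v i - u i) < \<delta>\<rbrakk>
         \<Longrightarrow> (\<Sum>i\<in>I. \<bar>g (v i) - g (u i)\<bar>) < 1"
    using absolutely_continuous_onE[OF assms zero_less_one] by blast
  show thesis
  proof (rule that[OF \<open>\<delta> > 0\<close>])
    fix p q d assume S: "{p..q} \<subseteq> S" and "p \<le> q" "q - p < \<delta>" and d: "d division_of {p..q}"
    note dD = division_of_realD[OF d]
    have "(\<Sum>k\<in>d. Sup k - Inf k) \<le> q - p"
      using dD \<open>p \<le> q\<close> by (intro sum_increments_le[where W = "\<lambda>x. x"]) (auto simp: mono_on_def)
    moreover have "Inf k \<le> Sup k \<and> {Inf k..Sup k} \<subseteq> S" if "k \<in> d" for k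
      using dD(2)[OF that] S by fastforce
    ultimately have "(\<Sum>k\<in>d. \<bar>g (Sup k) - g (Inf k)\<bar>) < 1"
      using dD \<open>q - p < \<delta>\<close> by (intro \<delta>) auto
    then show "(\<Sum>k\<in>d. \<bar>g (Sup k) - g (Inf k)\<bar>) \<le> 1" by simp
  qed
qed

theorem absolutely_continuous_differentiable_ae:
  fixes g :: "real \<Rightarrow> real"
  assumes g: "absolutely_continuous_on {a..b} g"
  shows "negligible {x \<in> {a..b}. \<not> g differentiable (at x)}"
proof (cases "a \<le> b")
  case True
  obtain \<delta> where "\<delta> > 0" and \<delta>: "\<And>p q d. {p..q} \<subseteq> {a..b} \<Longrightarrow> p \<le> q \<Longrightarrow> q - p < \<delta> \<Longrightarrow> d division_of {p..q} \<Longrightarrow>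
        (\<Sum>k\<in>d. \<bar>g (Sup k) - g (Inf k)\<bar>) \<le> 1"
    using absolutely_continuous_locally_bounded_variation[OF g] by blast
  have "a \<le> a \<and> b \<le> b \<longrightarrow> negligible {x \<in> {a..b}. \<not> g differentiable (at x)}"
    using True
  \<comment> \<open>the bound on the variation is available on short intervals only, so bisection passes to \<open>[a, b]\<close>\<close>
  proof (induction a b rule: Bolzano[where P = "\<lambda>p q. a \<le> p \<and> q \<le> b \<longrightarrow> negligible {x \<in> {p..q}. \<not> g differentiable (at x)}", consumes 1])
    case (trans p q r)
    show ?case
    proof
      assume "a \<le> p \<and> r \<le> b"
      with trans have "negligible ({x \<in> {p..q}. \<not> g differentiable (at x)} \<union> {x \<in> {q..r}. \<not> g differentiable (at x)})"
        by (intro negligible_Un) auto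
      then show "negligible {x \<in> {p..r}. \<not> g differentiable (at x)}"
        by (rule negligible_subset) auto
    qed
  next
    case (local x)
    show ?case
    proof (intro exI conjI allI impI)
      show "\<delta> > 0" by fact
      fix p q assume pq: "p \<le> x \<and> x \<le> q \<and> q - p < \<delta>" "a \<le> p \<and> q \<le> b"
      then have "negligible {x \<in> {p<..<q}. \<not> g differentiable (at x)}"
        by (intro bounded_variation_differentiable_ae[of _ _ _ 1] \<delta>) auto
      moreover have "negligible {p, q}" by simp
      ultimately have "negligible ({x \<in> {p<..<q}. \<not> g differentiable (at x)} \<union> {p, q})"
        by (rule negligible_Un)
      then show "negligible {x \<in> {p..q}. \<not> g differentiable (at x)}"
        by (rule negligible_subset) auto
    qed
  qed
  then show ?thesis by simp
qed simp

section \<open>The fundamental theorem of calculus for absolutely continuous functions\<close>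

lemma absolutely_continuous_on_subset:
  assumes g: "absolutely_continuous_on S g" and "T \<subseteq> S"
  shows "absolutely_continuous_on T g"
proof -
  have "(\<forall>(u, v)\<in>P. u < v \<and> {u..v} \<subseteq> S)" if "(\<forall>(u, v)\<in>P. u < v \<and> {u..v} \<subseteq> T)"
    for P :: "(real \<times> real) set"
    using that \<open>T \<subseteq> S\<close> by fast
  then show ?thesis using g unfolding absolutely_continuous_on_def by meson
qed

lemma absolutely_continuous_has_integral:
  fixes g h :: "real \<Rightarrow> real"
  assumes g: "absolutely_continuous_on {a..b} g" and "a \<le> b" and E: "negligible E"
    and h: "\<And>x. x \<in> {a..b} - E \<Longrightarrow> (g has_vector_derivative h x) (at x within {a..b})"
  shows "(h has_integral (g b - g a)) {a..b}"
proof -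
  define h0 where "h0 = (\<lambda>x. if x \<in> E then 0 else h x)"
  have "(h0 has_integral (g b - g a)) {a..b}"
    unfolding has_integral_real
  proof (intro allI impI)
    fix e :: real assume "e > 0"
    define e1 where "e1 = e / (2 * (b - a + 1))"
    have e1: "e1 > 0" "e1 * (b - a) \<le> e / 2"
      using \<open>e > 0\<close> \<open>a \<le> b\<close> by (auto simp: e1_def divide_simps)
    have "\<exists>d>0. \<forall>y\<in>{a..b}. norm (y - x) < d \<longrightarrow> norm (g y - g x - (y - x) *\<^sub>R h x) \<le> e1 * norm (y - x)"
      if "x \<in> {a..b} - E" for x
      using h[OF that] \<open>e1 > 0\<close> unfolding has_vector_derivative_def has_derivative_within_alt by blast
    then obtain d where d: "\<And>x. x \<in> {a..b} - E \<Longrightarrow> d x > 0"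
      "\<And>x y. \<lbrakk>x \<in> {a..b} - E; y \<in> {a..b}; norm (y - x) < d x\<rbrakk>
          \<Longrightarrow> norm (g y - g x - (y - x) *\<^sub>R h x) \<le> e1 * norm (y - x)"
      by metis
    have "e / 2 > 0" using \<open>e > 0\<close> by simp
    then obtain \<delta> where "\<delta> > 0" and \<delta>: "\<And>(I :: (real \<times> real set) set) u v. \<lbrakk>finite I; \<And>i. i \<in> I \<Longrightarrow> u i \<le> v i \<and> {u i..v i} \<subseteq> {a..b};
           disjoint_family_on (\<lambda>i. {u i<..<v i}) I; (\<Sum>i\<in>I. v i - u i) < \<delta>\<rbrakk>
         \<Longrightarrow> (\<Sum>i\<in>I. \<bar>g (v i) - g (u i)\<bar>) < e / 2"
      using absolutely_continuous_onE[OF g] by blast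
    have "E \<in> sets lebesgue" using E negligible_imp_sets by blast
    then obtain U where U: "open U" "E \<subseteq> U" "U - E \<in> lmeasurable" "emeasure lebesgue (U - E) < ennreal \<delta>"
      using sets_lebesgue_outer_open \<open>\<delta> > 0\<close> by metis
    have Um: "U \<in> lmeasurable" "measure lebesgue U < \<delta>"
    proof -
      have eq: "U = (U - E) \<union> E" using U(2) by blast
      have Em: "E \<in> lmeasurable" "measure lebesgue E = 0" using E by (auto simp: negligible_iff_measure)
      show "U \<in> lmeasurable" using fmeasurable.Un[OF U(3) Em(1)] eq by simp
      have "measure lebesgue U \<le> measure lebesgue (U - E) + measure lebesgue E"
        using measure_Un_le[of "U - E" lebesgue E] U(3) Em(1) eq by (auto dest: fmeasurableD)
      moreover have "measure lebesgue (U - E) < \<delta>"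
        using U(3,4) \<open>\<delta> > 0\<close> by (simp add: emeasure_eq_measure2 ennreal_less_iff)
      ultimately show "measure lebesgue U < \<delta>" using Em by simp
    qed
    \<comment> \<open>intervals tagged in \<open>E\<close> lie in \<open>U\<close>; outside \<open>[a, b]\<close> the value of the gauge is irrelevant\<close>
    define \<gamma> where "\<gamma> = (\<lambda>x. if x \<in> E then U else if x \<in> {a..b} then ball x (d x) else ball x 1)"
    have gauge: "gauge \<gamma>"
      using U d(1) by (auto simp: gauge_def \<gamma>_def)
    have small: "norm ((\<Sum>(x, k)\<in>D. measure lborel k *\<^sub>R h0 x) - (g b - g a)) < e"
      if D: "D tagged_division_of {a..b}" and fine: "\<gamma> fine D" for D
    proof -
      have fin: "finite D" using D by (rule tagged_division_of_finite)
      have k: "k = {Inf k..Sup k}" "Inf k \<le> x" "x \<le> Sup k" "a \<le> Inf k" "Sup k \<le> b" "k \<subseteq> \<gamma> x"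
        if xk: "(x, k) \<in> D" for x k
      proof -
        obtain u v where uv: "k = cbox u v" using tagged_division_ofD(4)[OF D xk] by blast
        have "x \<in> k" "k \<subseteq> {a..b}" using tagged_division_ofD(2,3)[OF D xk] by simp_all
        then show "k = {Inf k..Sup k}" "Inf k \<le> x" "x \<le> Sup k" "a \<le> Inf k" "Sup k \<le> b"
          using uv by auto
        show "k \<subseteq> \<gamma> x" using fine xk by blast
      qed
      have disj: "disjoint_family_on (\<lambda>i. {Inf (snd i)<..<Sup (snd i)}) D"
        unfolding disjoint_family_on_def
      proof (intro ballI impI)
        fix i j assume ij: "i \<in> D" "j \<in> D" "i \<noteq> j"
        have "interior (snd i) \<inter> interior (snd j) = {}"
          using tagged_division_ofD(5)[OF D, of "fst i" "snd i" "fst j" "snd j"] ij by simp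
        moreover have "interior (snd i) = {Inf (snd i)<..<Sup (snd i)}" "interior (snd j) = {Inf (snd j)<..<Sup (snd j)}"
          using arg_cong[OF k(1)[of "fst i" "snd i"], of interior] arg_cong[OF k(1)[of "fst j" "snd j"], of interior] ij
            interior_atLeastAtMost_real by simp_all
        ultimately show "{Inf (snd i)<..<Sup (snd i)} \<inter> {Inf (snd j)<..<Sup (snd j)} = {}" by simp
      qed
      \<comment> \<open>the pairs tagged in the exceptional set, where \<open>h0\<close> vanishes\<close>
      define DE where "DE = {i \<in> D. fst i \<in> E}"
      define inc where "inc = (\<lambda>i :: real \<times> real set. g (Sup (snd i)) - g (Inf (snd i)))"
      define len where "len = (\<lambda>i :: real \<times> real set. Sup (snd i) - Inf (snd i))"
      have sums: "(\<Sum>i\<in>D. inc i) = g b - g a" "(\<Sum>i\<in>D. len i) = b - a"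
        using additive_tagged_division_1[OF \<open>a \<le> b\<close> D, of g] additive_tagged_division_1[OF \<open>a \<le> b\<close> D, of "\<lambda>x. x"]
        by (simp_all add: inc_def len_def case_prod_unfold)
      have len0: "len i \<ge> 0" if "i \<in> D" for i
        using k[of "fst i" "snd i"] that by (simp add: len_def)
      have content: "measure lborel (snd i) = len i" if "i \<in> D" for i
        using k[of "fst i" "snd i"] that by (simp add: len_def) (metis content_real order_trans)
      have good: "\<bar>measure lborel (snd i) *\<^sub>R h0 (fst i) - inc i\<bar> \<le> e1 * len i" if i: "i \<in> D - DE" for i
      proof -
        obtain x K where xk: "i = (x, K)" by (cases i)
        define u v where "u = Inf K" and "v = Sup K"
        have xE: "x \<in> {a..b} - E" using i k[of x K] xk by (auto simp: DE_def)
        have uv: "u \<le> x" "x \<le> v" "a \<le> u" "v \<le> b" "K = {u..v}" "K \<subseteq> ball x (d x)"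
          using k[of x K] i xk xE by (auto simp: u_def v_def \<gamma>_def)
        have "u \<in> K" "v \<in> K" unfolding uv(5) using uv(1,2) by simp_all
        with uv(6) have "u \<in> ball x (d x)" "v \<in> ball x (d x)" by blast+
        then have "norm (g u - g x - (u - x) *\<^sub>R h x) \<le> e1 * norm (u - x)"
          "norm (g v - g x - (v - x) *\<^sub>R h x) \<le> e1 * norm (v - x)"
          using uv d(2)[OF xE, of u] d(2)[OF xE, of v] by (auto simp: dist_real_def)
        then have "\<bar>g u - g x - (u - x) * h x\<bar> \<le> e1 * (x - u)" "\<bar>g v - g x - (v - x) * h x\<bar> \<le> e1 * (v - x)"
          using uv by simp_all
        moreover have "(v - u) * h x - (g v - g u) = (g u - g x - (u - x) * h x) - (g v - g x - (v - x) * h x)"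
          "e1 * (v - u) = e1 * (x - u) + e1 * (v - x)"
          by (simp_all add: algebra_simps)
        ultimately have "\<bar>(v - u) * h x - (g v - g u)\<bar> \<le> e1 * (v - u)" by linarith
        then show ?thesis
          using content[of i] i xE xk by (simp add: inc_def len_def h0_def u_def v_def)
      qed
      have bad: "(\<Sum>i\<in>DE. \<bar>inc i\<bar>) < e / 2"
        unfolding inc_def
      proof (rule \<delta>)
        show "finite DE" using fin by (simp add: DE_def)
        show "Inf (snd i) \<le> Sup (snd i) \<and> {Inf (snd i)..Sup (snd i)} \<subseteq> {a..b}" if "i \<in> DE" for i
          using k(2-5)[of "fst i" "snd i"] that by (simp add: DE_def)
        show dDE: "disjoint_family_on (\<lambda>i. {Inf (snd i)<..<Sup (snd i)}) DE"
          by (rule disjoint_family_on_mono[OF _ disj]) (auto simp: DE_def)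
        have "(\<Sum>i\<in>DE. Sup (snd i) - Inf (snd i)) = (\<Sum>i\<in>DE. measure lebesgue {Inf (snd i)<..<Sup (snd i)})"
          using len0 by (intro sum.cong refl) (auto simp: DE_def len_def)
        also have "\<dots> = measure lebesgue (\<Union>i\<in>DE. {Inf (snd i)<..<Sup (snd i)})"
          using dDE \<open>finite DE\<close> by (intro measure_finite_Union[symmetric]) (use len0 in \<open>auto simp: DE_def len_def\<close>)
        also have "\<dots> \<le> measure lebesgue U"
        proof (rule measure_mono_fmeasurable)
          show "(\<Union>i\<in>DE. {Inf (snd i)<..<Sup (snd i)}) \<subseteq> U"
          proof safe
            fix x K y assume "(x, K) \<in> DE" and y: "y \<in> {Inf (snd (x, K))<..<Sup (snd (x, K))}"
            then have "(x, K) \<in> D" "x \<in> E" by (auto simp: DE_def)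
            have "K = {Inf K..Sup K}" by (rule k(1)[OF \<open>(x, K) \<in> D\<close>])
            then have "y \<in> K" using y by (metis atLeastAtMost_iff greaterThanLessThan_iff less_imp_le snd_conv)
            moreover have "K \<subseteq> U" using k(6)[OF \<open>(x, K) \<in> D\<close>] \<open>x \<in> E\<close> by (simp add: \<gamma>_def)
            ultimately show "y \<in> U" by blast
          qed
        qed (use Um(1) \<open>finite DE\<close> in auto)
        also have "\<dots> < \<delta>" by (rule Um)
        finally show "(\<Sum>i\<in>DE. Sup (snd i) - Inf (snd i)) < \<delta>" .
      qed
      have "\<bar>(\<Sum>i\<in>D. measure lborel (snd i) *\<^sub>R h0 (fst i)) - (g b - g a)\<bar> = \<bar>\<Sum>i\<in>D. measure lborel (snd i) *\<^sub>R h0 (fst i) - inc i\<bar>"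
        by (simp add: sums sum_subtractf)
      also have "\<dots> \<le> (\<Sum>i\<in>D. \<bar>measure lborel (snd i) *\<^sub>R h0 (fst i) - inc i\<bar>)" by (rule sum_abs)
      also have "\<dots> = (\<Sum>i\<in>D - DE. \<bar>measure lborel (snd i) *\<^sub>R h0 (fst i) - inc i\<bar>) + (\<Sum>i\<in>DE. \<bar>measure lborel (snd i) *\<^sub>R h0 (fst i) - inc i\<bar>)"
        using fin by (intro sum.subset_diff) (auto simp: DE_def)
      also have "(\<Sum>i\<in>DE. \<bar>measure lborel (snd i) *\<^sub>R h0 (fst i) - inc i\<bar>) = (\<Sum>i\<in>DE. \<bar>inc i\<bar>)"
        by (intro sum.cong) (auto simp: DE_def h0_def)
      also have "(\<Sum>i\<in>D - DE. \<bar>measure lborel (snd i) *\<^sub>R h0 (fst i) - inc i\<bar>) \<le> (\<Sum>i\<in>D - DE. e1 * len i)"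
        using good by (rule sum_mono)
      also have "\<dots> \<le> (\<Sum>i\<in>D. e1 * len i)"
        using fin len0 e1 by (intro sum_mono2) auto
      also have "\<dots> = e1 * (b - a)" by (simp add: sum_distrib_left[symmetric] sums)
      finally show ?thesis using bad e1 by (simp add: case_prod_unfold)
    qed
    show "\<exists>\<gamma>. gauge \<gamma> \<and> (\<forall>D. D tagged_division_of {a..b} \<and> \<gamma> fine D \<longrightarrow>
        norm ((\<Sum>(x, k)\<in>D. measure lborel k *\<^sub>R h0 x) - (g b - g a)) < e)"
      using gauge small by (intro exI[of _ \<gamma>]) blast
  qed
  then show ?thesis
    by (rule has_integral_spike[OF E, rotated]) (simp add: h0_def)
qed

theorem absolutely_continuous_absolutely_integrable_derivative:
  fixes g h :: "real \<Rightarrow> real"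
  assumes g: "absolutely_continuous_on {a..b} g" and "a \<le> b" and E: "negligible E"
    and h: "\<And>x. x \<in> {a..b} - E \<Longrightarrow> (g has_vector_derivative h x) (at x within {a..b})"
  shows "h absolutely_integrable_on {a..b}"
proof -
  have int: "(h has_integral (g q - g p)) {p..q}" if "a \<le> p" "p \<le> q" "q \<le> b" for p q
  proof (rule absolutely_continuous_has_integral[OF _ \<open>p \<le> q\<close> E])
    show "absolutely_continuous_on {p..q} g"
      using that by (intro absolutely_continuous_on_subset[OF g]) auto
    show "(g has_vector_derivative h x) (at x within {p..q})" if "x \<in> {p..q} - E" for x
      using \<open>a \<le> p\<close> \<open>q \<le> b\<close> that
      by (intro has_vector_derivative_within_subset[OF h]) auto
  qed
  obtain \<delta> where "\<delta> > 0" and \<delta>: "\<And>p q d. {p..q} \<subseteq> {a..b} \<Longrightarrow> p \<le> q \<Longrightarrow> q - p < \<delta> \<Longrightarrow> d division_of {p..q} \<Longrightarrow>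
        (\<Sum>k\<in>d. \<bar>g (Sup k) - g (Inf k)\<bar>) \<le> 1"
    using absolutely_continuous_locally_bounded_variation[OF g] by blast
  have "a \<le> a \<and> b \<le> b \<longrightarrow> h absolutely_integrable_on {a..b}"
    using \<open>a \<le> b\<close>
  \<comment> \<open>on short intervals the indefinite integral \<open>g\<close> has variation at most 1; bisection passes to \<open>[a, b]\<close>\<close>
  proof (induction a b rule: Bolzano[where P = "\<lambda>p q. a \<le> p \<and> q \<le> b \<longrightarrow> h absolutely_integrable_on {p..q}", consumes 1])
    case (trans p q r)
    show ?case
    proof
      assume "a \<le> p \<and> r \<le> b"
      with trans have "h absolutely_integrable_on ({p..q} \<union> {q..r})"
        by (intro absolutely_integrable_Un) auto
      moreover have "{p..q} \<union> {q..r} = {p..r}" using trans by auto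
      ultimately show "h absolutely_integrable_on {p..r}" by simp
    qed
  next
    case (local x)
    show ?case
    proof (intro exI conjI allI impI)
      show "\<delta> > 0" by fact
      fix p q assume pq: "p \<le> x \<and> x \<le> q \<and> q - p < \<delta>" "a \<le> p \<and> q \<le> b"
      have "h absolutely_integrable_on cbox p q"
      proof (rule bounded_variation_absolutely_integrable_interval)
        show "h integrable_on cbox p q" using int[of p q] pq by auto
        fix d assume "d division_of cbox p q"
        then have d: "d division_of {p..q}" by simp
        note dD = division_of_realD[OF d]
        have "(\<Sum>k\<in>d. norm (integral k h)) = (\<Sum>k\<in>d. \<bar>g (Sup k) - g (Inf k)\<bar>)"
        proof (rule sum.cong[OF refl])
          fix k assume "k \<in> d"
          then have k: "k = {Inf k..Sup k}" "p \<le> Inf k" "Inf k \<le> Sup k" "Sup k \<le> q" using dD(2) by blast+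
          have "integral {Inf k..Sup k} h = g (Sup k) - g (Inf k)"
            using k pq by (intro integral_unique int) auto
          then show "norm (integral k h) = \<bar>g (Sup k) - g (Inf k)\<bar>" using k(1) by simp
        qed
        also have "\<dots> \<le> 1" using pq by (intro \<delta>[OF _ _ _ d]) auto
        finally show "(\<Sum>k\<in>d. norm (integral k h)) \<le> 1" .
      qed
      then show "h absolutely_integrable_on {p..q}" by simp
    qed
  qed
  then show ?thesis by simp
qed

section \<open>Closure properties of absolute continuity\<close>

text \<open>The common source of the closure properties: a function whose increments are controlled by those of two
absolutely continuous functions is absolutely continuous.\<close>

lemma absolutely_continuous_on_dominated:
  fixes f g h :: "real \<Rightarrow> real"
  assumes g: "absolutely_continuous_on S g" and h: "absolutely_continuous_on S h"
    and M: "\<And>u v. u \<in> S \<Longrightarrow> v \<in> S \<Longrightarrow> \<bar>f v - f u\<bar> \<le> M * \<bar>g v - g u\<bar> + M * \<bar>h v - h u\<bar>"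
    and "M \<ge> 0"
  shows "absolutely_continuous_on S f"
  unfolding absolutely_continuous_on_def
proof (intro allI impI)
  fix e :: real assume "e > 0"
  define e1 where "e1 = e / (2 * (M + 1))"
  have "e1 > 0" "2 * M * e1 < e" using \<open>e > 0\<close> \<open>M \<ge> 0\<close> by (auto simp: e1_def field_simps)
  obtain d1 where "d1 > 0" and d1: "\<And>P. finite P \<and> (\<forall>(u, v)\<in>P. u < v \<and> {u..v} \<subseteq> S) \<and>
        disjoint_family_on (\<lambda>(u, v). {u<..<v}) P \<and> (\<Sum>(u, v)\<in>P. v - u) < d1 \<Longrightarrow> (\<Sum>(u, v)\<in>P. \<bar>g v - g u\<bar>) < e1"
    using g[unfolded absolutely_continuous_on_def, rule_format, OF \<open>e1 > 0\<close>] by auto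
  obtain d2 where "d2 > 0" and d2: "\<And>P. finite P \<and> (\<forall>(u, v)\<in>P. u < v \<and> {u..v} \<subseteq> S) \<and>
        disjoint_family_on (\<lambda>(u, v). {u<..<v}) P \<and> (\<Sum>(u, v)\<in>P. v - u) < d2 \<Longrightarrow> (\<Sum>(u, v)\<in>P. \<bar>h v - h u\<bar>) < e1"
    using h[unfolded absolutely_continuous_on_def, rule_format, OF \<open>e1 > 0\<close>] by auto
  show "\<exists>\<delta>>0. \<forall>P. finite P \<and> (\<forall>(u, v)\<in>P. u < v \<and> {u..v} \<subseteq> S) \<and>
        disjoint_family_on (\<lambda>(u, v). {u<..<v}) P \<and> (\<Sum>(u, v)\<in>P. v - u) < \<delta> \<longrightarrow> (\<Sum>(u, v)\<in>P. \<bar>f v - f u\<bar>) < e"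
  proof (intro exI[of _ "min d1 d2"] conjI allI impI)
    show "min d1 d2 > 0" using \<open>d1 > 0\<close> \<open>d2 > 0\<close> by simp
    fix P :: "(real \<times> real) set"
    assume P: "finite P \<and> (\<forall>(u, v)\<in>P. u < v \<and> {u..v} \<subseteq> S) \<and>
        disjoint_family_on (\<lambda>(u, v). {u<..<v}) P \<and> (\<Sum>(u, v)\<in>P. v - u) < min d1 d2"
    have "(\<Sum>(u, v)\<in>P. \<bar>f v - f u\<bar>) \<le> (\<Sum>(u, v)\<in>P. M * \<bar>g v - g u\<bar> + M * \<bar>h v - h u\<bar>)"
    proof (rule sum_mono)
      fix i assume i: "i \<in> P"
      obtain u v where uv: "i = (u, v)" by (cases i)
      with P i have "u < v" "{u..v} \<subseteq> S" by auto
      then have "u \<in> S" "v \<in> S" by auto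
      from M[OF this] show "(case i of (u, v) \<Rightarrow> \<bar>f v - f u\<bar>) \<le> (case i of (u, v) \<Rightarrow> M * \<bar>g v - g u\<bar> + M * \<bar>h v - h u\<bar>)"
        by (simp add: uv)
    qed
    also have "\<dots> = M * (\<Sum>(u, v)\<in>P. \<bar>g v - g u\<bar>) + M * (\<Sum>(u, v)\<in>P. \<bar>h v - h u\<bar>)"
      by (simp add: case_prod_unfold sum.distrib sum_distrib_left)
    also have "\<dots> \<le> M * e1 + M * e1"
      using d1[of P] d2[of P] P \<open>M \<ge> 0\<close> by (intro add_mono mult_left_mono) auto
    also have "\<dots> < e" using \<open>2 * M * e1 < e\<close> by simp
    finally show "(\<Sum>(u, v)\<in>P. \<bar>f v - f u\<bar>) < e" .
  qed
qed

lemma absolutely_continuous_on_ident: "absolutely_continuous_on S (\<lambda>x. x)"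
  unfolding absolutely_continuous_on_def
proof (intro allI impI)
  fix e :: real assume "e > 0"
  moreover have "(\<Sum>(u, v)\<in>P. \<bar>v - u\<bar>) = (\<Sum>(u, v)\<in>P. v - u)"
    if "\<forall>(u, v)\<in>P. u < v \<and> {u..v} \<subseteq> S" for P :: "(real \<times> real) set"
    using that by (intro sum.cong) auto
  ultimately show "\<exists>\<delta>>0. \<forall>P. finite P \<and> (\<forall>(u, v)\<in>P. u < v \<and> {u..v} \<subseteq> S) \<and>
        disjoint_family_on (\<lambda>(u, v). {u<..<v}) P \<and> (\<Sum>(u, v)\<in>P. v - u) < \<delta> \<longrightarrow> (\<Sum>(u, v)\<in>P. \<bar>v - u\<bar>) < e"
    by (intro exI[of _ e]) simp
qed

lemma absolutely_continuous_on_imp_continuous_on: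
  fixes g :: "real \<Rightarrow> real"
  assumes g: "absolutely_continuous_on {a..b} g"
  shows "continuous_on {a..b} g"
  unfolding continuous_on_iff
proof (intro ballI allI impI)
  fix x e :: real assume x: "x \<in> {a..b}" and "e > 0"
  obtain d where "d > 0" and d: "\<And>(I :: unit set) u v. \<lbrakk>finite I; \<And>i. i \<in> I \<Longrightarrow> u i \<le> v i \<and> {u i..v i} \<subseteq> {a..b};
           disjoint_family_on (\<lambda>i. {u i<..<v i}) I; (\<Sum>i\<in>I. v i - u i) < d\<rbrakk>
         \<Longrightarrow> (\<Sum>i\<in>I. \<bar>g (v i) - g (u i)\<bar>) < e"
    using absolutely_continuous_onE[OF g \<open>e > 0\<close>] by blast
  show "\<exists>d>0. \<forall>x'\<in>{a..b}. dist x' x < d \<longrightarrow> dist (g x') (g x) < e"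
  proof (intro exI conjI ballI impI)
    show "d > 0" by fact
    fix y assume "y \<in> {a..b}" "dist y x < d"
    then have "\<bar>g (max x y) - g (min x y)\<bar> < e"
      using d[of UNIV "\<lambda>_. min x y" "\<lambda>_. max x y"] x
      by (simp add: disjoint_family_on_def dist_real_def abs_if split: if_splits)
    then show "dist (g y) (g x) < e"
      by (simp add: dist_real_def max_def min_def split: if_splits)
  qed
qed

lemma absolutely_continuous_on_add:
  fixes f g :: "real \<Rightarrow> real"
  assumes "absolutely_continuous_on S f" "absolutely_continuous_on S g"
  shows "absolutely_continuous_on S (\<lambda>x. f x + g x)"
proof (rule absolutely_continuous_on_dominated[OF assms])
  show "\<bar>(f v + g v) - (f u + g u)\<bar> \<le> 1 * \<bar>f v - f u\<bar> + 1 * \<bar>g v - g u\<bar>" for u v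
    using abs_triangle_ineq[of "f v - f u" "g v - g u"] by (simp add: algebra_simps)
qed simp

lemma absolutely_continuous_on_sum:
  assumes "finite I" "\<And>i. i \<in> I \<Longrightarrow> absolutely_continuous_on S (f i)"
  shows "absolutely_continuous_on S (\<lambda>x. \<Sum>i\<in>I. f i x)"
  using assms
proof (induction I rule: finite_induct)
  case empty
  show ?case
    by (rule absolutely_continuous_on_dominated[OF absolutely_continuous_on_ident absolutely_continuous_on_ident, of _ _ 0]) auto
qed (auto intro: absolutely_continuous_on_add)

lemma absolutely_continuous_on_mult:
  fixes f g :: "real \<Rightarrow> real"
  assumes f: "absolutely_continuous_on {a..b} f" and g: "absolutely_continuous_on {a..b} g"
  shows "absolutely_continuous_on {a..b} (\<lambda>x. f x * g x)"
proof -
  have bd: "bounded (h ` {a..b})" if "absolutely_continuous_on {a..b} h" for h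
    using that by (intro compact_imp_bounded compact_continuous_image absolutely_continuous_on_imp_continuous_on) auto
  obtain A where A: "\<And>x. x \<in> {a..b} \<Longrightarrow> \<bar>f x\<bar> \<le> A"
    using bd[OF f] unfolding bounded_iff by fastforce
  obtain B where B: "\<And>x. x \<in> {a..b} \<Longrightarrow> \<bar>g x\<bar> \<le> B"
    using bd[OF g] unfolding bounded_iff by fastforce
  define M where "M = max 0 (max A B)"
  show ?thesis
  proof (rule absolutely_continuous_on_dominated[OF f g])
    fix u v assume uv: "u \<in> {a..b}" "v \<in> {a..b}"
    have "f v * g v - f u * g u = g v * (f v - f u) + f u * (g v - g u)" by (simp add: algebra_simps)
    then have "\<bar>f v * g v - f u * g u\<bar> \<le> \<bar>g v\<bar> * \<bar>f v - f u\<bar> + \<bar>f u\<bar> * \<bar>g v - g u\<bar>"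
      by (metis abs_mult abs_triangle_ineq)
    also have "\<dots> \<le> M * \<bar>f v - f u\<bar> + M * \<bar>g v - g u\<bar>"
      using A[OF uv(1)] B[OF uv(2)] by (intro add_mono mult_right_mono) (auto simp: M_def)
    finally show "\<bar>f v * g v - f u * g u\<bar> \<le> M * \<bar>f v - f u\<bar> + M * \<bar>g v - g u\<bar>" .
  qed (simp add: M_def)
qed

lemma C1_imp_absolutely_continuous_on:
  fixes f f' :: "real \<Rightarrow> real"
  assumes f: "\<And>x. x \<in> {a..b} \<Longrightarrow> (f has_vector_derivative f' x) (at x within {a..b})"
    and f': "continuous_on {a..b} f'"
  shows "absolutely_continuous_on {a..b} f"
proof -
  have "bounded (f' ` {a..b})"
    using f' by (auto intro!: compact_imp_bounded compact_continuous_image)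
  then obtain A where A: "\<And>x. x \<in> {a..b} \<Longrightarrow> \<bar>f' x\<bar> \<le> A"
    unfolding bounded_iff by fastforce
  define M where "M = max 0 A"
  show ?thesis
  proof (rule absolutely_continuous_on_dominated[OF absolutely_continuous_on_ident absolutely_continuous_on_ident])
    fix u v assume uv: "u \<in> {a..b}" "v \<in> {a..b}"
    have "norm (f v - f u) \<le> M * norm (v - u)"
    proof (rule field_differentiable_bound[OF convex_real_interval(5) _ _ uv(2,1)])
      fix x assume x: "x \<in> {a..b}"
      show "(f has_field_derivative f' x) (at x within {a..b})"
        using f[OF x] by (simp add: has_real_derivative_iff_has_vector_derivative)
      show "norm (f' x) \<le> M" using A[OF x] by (simp add: M_def)
    qed
    moreover have "M * \<bar>v - u\<bar> \<ge> 0" by (simp add: M_def)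
    ultimately show "\<bar>f v - f u\<bar> \<le> M * \<bar>v - u\<bar> + M * \<bar>v - u\<bar>" by simp
  qed (simp add: M_def)
qed

section \<open>Taylor's formula\<close>

lemma has_vector_derivative_taylor_sum:
  fixes D :: "nat \<Rightarrow> real \<Rightarrow> real"
  assumes "\<And>k. k \<le> n \<Longrightarrow> (D k has_vector_derivative D (Suc k) t) (at t within S)"
  shows "((\<lambda>t. \<Sum>k\<le>n. (x - t) ^ k / fact k * D k t) has_vector_derivative
     (x - t) ^ n / fact n * D (Suc n) t) (at t within S)"
  using assms
proof (induction n)
  case 0
  then show ?case by simp
next
  case (Suc n)
  have D: "(D (Suc n) has_field_derivative D (Suc (Suc n)) t) (at t within S)"
    using Suc.prems[of "Suc n"] by (simp add: has_real_derivative_iff_has_vector_derivative)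
  have IH: "((\<lambda>t. \<Sum>k\<le>n. (x - t) ^ k / fact k * D k t) has_field_derivative
     (x - t) ^ n / fact n * D (Suc n) t) (at t within S)"
    using Suc by (simp add: has_real_derivative_iff_has_vector_derivative)
  have "((\<lambda>t. (x - t) ^ Suc n / fact (Suc n)) has_field_derivative - ((x - t) ^ n / fact n)) (at t within S)"
    by (rule derivative_eq_intros refl | simp add: field_simps del: of_nat_Suc)+
  from DERIV_mult[OF this D]
  have "((\<lambda>t. (x - t) ^ Suc n / fact (Suc n) * D (Suc n) t) has_field_derivative
      (x - t) ^ Suc n / fact (Suc n) * D (Suc (Suc n)) t - (x - t) ^ n / fact n * D (Suc n) t) (at t within S)"
    by (rule DERIV_cong) (simp add: algebra_simps)
  from DERIV_add[OF IH this]
  show ?case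
    by (simp add: has_real_derivative_iff_has_vector_derivative)
qed

theorem theorem2:
  fixes a b :: real and N :: nat and f :: "real \<Rightarrow> real"
  assumes "a < b"
    and "has_nth_deriv_on {a..b} N f"
    and "absolutely_continuous_on {a..b} (nth_deriv_on {a..b} N f)"
  shows "(AE t\<in>{a..b} in lebesgue. nth_deriv_on {a..b} N f differentiable (at t within {a..b}))
    \<and> set_integrable lebesgue {a..b} (nth_deriv_on {a..b} (Suc N) f)
    \<and> (\<forall>x\<in>{a..b}.
        set_integrable lebesgue {a..x} (\<lambda>t. (x - t) ^ N / fact N * nth_deriv_on {a..b} (Suc N) f t)
        \<and> (let R = (LINT t:{a..x}|lebesgue. (x - t) ^ N / fact N * nth_deriv_on {a..b} (Suc N) f t)
           in f x = (\<Sum>k\<le>N. (x - a) ^ k / fact k * nth_deriv_on {a..b} k f a) + R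
              \<and> ennreal \<bar>R\<bar>
                 \<le> (SUP c\<in>{c\<in>{a..x}. nth_deriv_on {a..b} N f differentiable (at c within {a..b})}.
                       ennreal \<bar>nth_deriv_on {a..b} (Suc N) f c\<bar>)
                    * ennreal ((x - a) ^ (N + 1) / fact (N + 1))))"
proof -
  define D where "D = (\<lambda>k. nth_deriv_on {a..b} k f)"
  have D_Suc: "D (Suc k) x = vector_derivative (D k) (at x within {a..b})" for k x
    by (simp add: D_def)
  have D_deriv: "(D k has_vector_derivative D (Suc k) x) (at x within {a..b})"
    if "D k differentiable (at x within {a..b})" for k x
    using that unfolding D_Suc by (simp add: vector_derivative_works)
  have diff: "D k differentiable (at x within {a..b})" if "k < N" "x \<in> {a..b}" for k x
    using assms(2) that by (simp add: has_nth_deriv_on_def D_def)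
  have AC_N: "absolutely_continuous_on {a..b} (D N)" using assms(3) by (simp add: D_def)
  have cont: "continuous_on {a..b} (D k)" if "k \<le> N" for k
  proof (cases "k = N")
    case True
    then show ?thesis using absolutely_continuous_on_imp_continuous_on[OF AC_N] by simp
  next
    case False
    with that have "k < N" by simp
    then show ?thesis
      using diff[of k] by (simp add: continuous_on_eq_continuous_within differentiable_imp_continuous_within)
  qed
  have AC: "absolutely_continuous_on {a..b} (D k)" if "k \<le> N" for k
  proof (cases "k = N")
    case False
    with that have "k < N" by simp
    then show ?thesis
      by (intro C1_imp_absolutely_continuous_on[of _ _ _ "D (Suc k)"] D_deriv diff cont) auto
  qed (simp add: AC_N)
  define E where "E = {t \<in> {a..b}. \<not> D N differentiable (at t within {a..b})}"
  have E: "negligible E"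
    by (rule negligible_subset[OF absolutely_continuous_differentiable_ae[OF AC_N]])
      (auto simp: E_def intro: differentiable_at_withinI)
  have D_N: "(D N has_vector_derivative D (Suc N) t) (at t within {a..b})" if "t \<in> {a..b} - E" for t
    using that by (intro D_deriv) (auto simp: E_def)
  have ae: "AE t\<in>{a..b} in lebesgue. D N differentiable (at t within {a..b})"
    using E by (intro AE_I'[of E]) (auto simp: negligible_iff_null_sets E_def)
  have int: "D (Suc N) absolutely_integrable_on {a..b}"
    using \<open>a < b\<close> by (intro absolutely_continuous_absolutely_integrable_derivative[OF AC_N _ E D_N]) auto
  have main: "(\<lambda>t. (x - t) ^ N / fact N * D (Suc N) t) absolutely_integrable_on {a..x}"
    "((\<lambda>t. (x - t) ^ N / fact N * D (Suc N) t) has_integral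
        (f x - (\<Sum>k\<le>N. (x - a) ^ k / fact k * D k a))) {a..x}"
    if x: "x \<in> {a..b}" for x
  proof -
    define \<phi> where "\<phi> = (\<lambda>t. \<Sum>k\<le>N. (x - t) ^ k / fact k * D k t)"
    have AC_pow: "absolutely_continuous_on {a..b} (\<lambda>t. (x - t) ^ k / fact k)" for k
      by (rule C1_imp_absolutely_continuous_on[of _ _ _ "\<lambda>t. - (real k * (x - t) ^ (k - 1) / fact k)"])
        (auto intro!: derivative_eq_intros continuous_intros simp flip: has_real_derivative_iff_has_vector_derivative)
    have "absolutely_continuous_on {a..b} \<phi>"
      unfolding \<phi>_def by (intro absolutely_continuous_on_sum absolutely_continuous_on_mult AC_pow AC) auto
    then have AC_\<phi>: "absolutely_continuous_on {a..x} \<phi>"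
      using x by (elim absolutely_continuous_on_subset) auto
    have \<phi>': "(\<phi> has_vector_derivative (x - t) ^ N / fact N * D (Suc N) t) (at t within {a..x})"
      if t: "t \<in> {a..x} - E" for t
      unfolding \<phi>_def
    proof (rule has_vector_derivative_taylor_sum)
      fix k assume "k \<le> N"
      have tb: "t \<in> {a..b} - E" using t x by auto
      have "(D k has_vector_derivative D (Suc k) t) (at t within {a..b})"
        using D_N[OF tb] D_deriv[OF diff[of k t]] tb \<open>k \<le> N\<close> by (cases "k = N") auto
      then show "(D k has_vector_derivative D (Suc k) t) (at t within {a..x})"
        by (rule has_vector_derivative_within_subset) (use x in auto)
    qed
    have "a \<le> x" using x by simp
    note absolutely_continuous_absolutely_integrable_derivative[OF AC_\<phi> this E \<phi>']
    then show "(\<lambda>t. (x - t) ^ N / fact N * D (Suc N) t) absolutely_integrable_on {a..x}" by simp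
    \<comment> \<open>at \<open>t = x\<close> only the term \<open>k = 0\<close> survives, with \<open>0^0 = 1\<close>\<close>
    have "\<phi> x = (\<Sum>k\<in>{0}. (x - x) ^ k / fact k * D k x)"
      unfolding \<phi>_def by (rule sum.mono_neutral_right) auto
    then have "\<phi> x = f x" by (simp add: D_def)
    moreover have "\<phi> a = (\<Sum>k\<le>N. (x - a) ^ k / fact k * D k a)" by (simp add: \<phi>_def)
    ultimately show "((\<lambda>t. (x - t) ^ N / fact N * D (Suc N) t) has_integral
        (f x - (\<Sum>k\<le>N. (x - a) ^ k / fact k * D k a))) {a..x}"
      using absolutely_continuous_has_integral[OF AC_\<phi> \<open>a \<le> x\<close> E \<phi>'] by simp
  qed
  have bound: "ennreal \<bar>R\<bar> \<le> (SUP c\<in>{c\<in>{a..x}. D N differentiable (at c within {a..b})}. ennreal \<bar>D (Suc N) c\<bar>)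
      * ennreal ((x - a) ^ (N + 1) / fact (N + 1))" (is "_ \<le> ?S * _")
    if x: "x \<in> {a..b}" and R: "((\<lambda>t. (x - t) ^ N / fact N * D (Suc N) t) has_integral R) {a..x}" for x R
  proof (cases "x = a")
    case True
    then have "R = 0" using R by (auto dest: has_integral_unique[OF has_integral_refl(2)])
    then show ?thesis by simp
  next
    case False
    with x have "a < x" by simp
    then have pos: "(x - a) ^ (N + 1) / fact (N + 1) > 0" by simp
    show ?thesis
    proof (cases ?S)
      case top
      have "ennreal ((x - a) ^ (N + 1) / fact (N + 1)) \<noteq> 0"
        using pos by (simp only: ennreal_eq_0_iff not_le)
      then have "?S * ennreal ((x - a) ^ (N + 1) / fact (N + 1)) = top"
        unfolding top by (simp only: ennreal_top_mult if_False)
      then show ?thesis by (simp only: top_greatest)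
    next
      case (real M)
      have M: "\<bar>D (Suc N) t\<bar> \<le> M" if "t \<in> {a..x} - E" for t
      proof -
        have "ennreal \<bar>D (Suc N) t\<bar> \<le> ?S"
          using that x by (intro SUP_upper) (auto simp: E_def)
        then have "ennreal \<bar>D (Suc N) t\<bar> \<le> ennreal M" unfolding real(2) .
        then show ?thesis using real(1) by (simp add: ennreal_le_iff)
      qed
      \<comment> \<open>the bound by \<open>M\<close> may fail on \<open>E\<close>, so the integrand is changed to 0 there\<close>
      define w where "w = (\<lambda>t. if t \<in> E then 0 else (x - t) ^ N / fact N * D (Suc N) t)"
      have w: "(w has_integral R) {a..x}"
        by (rule has_integral_spike[OF E _ R]) (simp add: w_def)
      have "((\<lambda>t. M * ((x - t) ^ N / fact N)) has_integral
          (- (M * ((x - x) ^ (N + 1) / fact (N + 1))) - - (M * ((x - a) ^ (N + 1) / fact (N + 1))))) {a..x}"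
      proof (rule fundamental_theorem_of_calculus)
        show "a \<le> x" using \<open>a < x\<close> by simp
        fix t
        have "((\<lambda>t. - (M * ((x - t) ^ (N + 1) / fact (N + 1)))) has_field_derivative M * ((x - t) ^ N / fact N)) (at t within {a..x})"
          by (rule derivative_eq_intros refl | simp add: field_simps del: of_nat_Suc)+
        then show "((\<lambda>t. - (M * ((x - t) ^ (N + 1) / fact (N + 1)))) has_vector_derivative M * ((x - t) ^ N / fact N)) (at t within {a..x})"
          by (simp only: has_real_derivative_iff_has_vector_derivative)
      qed
      then have Mw: "((\<lambda>t. M * ((x - t) ^ N / fact N)) has_integral M * ((x - a) ^ (N + 1) / fact (N + 1))) {a..x}"
        by simp
      have "norm (integral {a..x} w) \<le> integral {a..x} (\<lambda>t. M * ((x - t) ^ N / fact N))"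
      proof (rule integral_norm_bound_integral)
        show "w integrable_on {a..x}" "(\<lambda>t. M * ((x - t) ^ N / fact N)) integrable_on {a..x}"
          using w Mw by blast+
        fix t assume t: "t \<in> {a..x}"
        show "norm (w t) \<le> M * ((x - t) ^ N / fact N)"
        proof (cases "t \<in> E")
          case False
          have "\<bar>D (Suc N) t\<bar> * ((x - t) ^ N / fact N) \<le> M * ((x - t) ^ N / fact N)"
            using M[of t] t False by (intro mult_right_mono) auto
          then show ?thesis using t False by (simp add: w_def abs_mult mult.commute)
        qed (use t real in \<open>auto simp: w_def\<close>)
      qed
      then have "\<bar>R\<bar> \<le> M * ((x - a) ^ (N + 1) / fact (N + 1))"
        unfolding integral_unique[OF w] integral_unique[OF Mw] by simp
      then have "ennreal \<bar>R\<bar> \<le> ennreal M * ennreal ((x - a) ^ (N + 1) / fact (N + 1))"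
        using real(1) pos by (simp only: ennreal_mult[symmetric] less_imp_le ennreal_leI)
      then show ?thesis unfolding real(2) .
    qed
  qed
  have D_eq: "nth_deriv_on {a..b} k f = D k" for k by (simp add: D_def)
  show ?thesis
    unfolding Let_def D_eq
  proof (intro conjI ballI)
    fix x assume x: "x \<in> {a..b}"
    show int_x: "set_integrable lebesgue {a..x} (\<lambda>t. (x - t) ^ N / fact N * D (Suc N) t)"
      by (rule main(1)[OF x])
    have R: "(LINT t:{a..x}|lebesgue. (x - t) ^ N / fact N * D (Suc N) t) =
        f x - (\<Sum>k\<le>N. (x - a) ^ k / fact k * D k a)"
      unfolding set_lebesgue_integral_eq_integral(2)[OF int_x] by (rule integral_unique[OF main(2)[OF x]])
    then show "f x = (\<Sum>k\<le>N. (x - a) ^ k / fact k * D k a) +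
        (LINT t:{a..x}|lebesgue. (x - t) ^ N / fact N * D (Suc N) t)"
      by simp
    show "ennreal \<bar>LINT t:{a..x}|lebesgue. (x - t) ^ N / fact N * D (Suc N) t\<bar> \<le>
        (SUP c\<in>{c \<in> {a..x}. D N differentiable (at c within {a..b})}. ennreal \<bar>D (Suc N) c\<bar>)
        * ennreal ((x - a) ^ (N + 1) / fact (N + 1))"
      unfolding R by (rule bound[OF x main(2)[OF x]])
  qed (rule ae int)+
qed

end
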